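(* Let $\pi/2\leq\alpha<\pi$ and let $f(z)=z+\sum_{n=2}^\infty a_nz^n$ be in the class $\mathcal{M}_\Sigma(\alpha)$. Then $$|a_2|\leq\sqrt{\frac{2}{2+\cos\alpha}},$$ and for any real number $\mu$, $$|a_3-\mu a_2^2|\leq\begin{cases}\frac12, & \text{if } |1-\mu|\leq\frac12\left(1+\frac12\cos\alpha\right),\\ \frac{|1-\mu|}{1+\frac12\cos\alpha}, & \text{if } |1-\mu|\geq\frac12\left(1+\frac12\cos\alpha\right).\end{cases}$$
   Context: $\Delta=\{z\in\mathbb{C}:|z|<1\}$. $\mathcal{A}$ is the class of functions $f$ analytic in $\Delta$ of the form $f(z)=z+\sum_{n=2}^\infty a_nz^n$. A function $f\in\mathcal{A}$ is bi-univalent in $\Delta$ if both $f$ and $f^{-1}$ are univalent (analytic and one-to-one) in $\Delta$; here $f^{-1}$ is the local inverse of $f$ near $0$ with $f^{-1}(0)=0$, understood as analytically continued to $\Delta$. $\Sigma$ is the class of bi-univalent functions in $\Delta$. For $f\in\Sigma$ write $g=f^{-1}$, so $g(w)=w-a_2w^2+(2a_2^2-a_3)w^3-(5a_2^3-5a_2a_3+a_4)w^4+\cdots$. For $\pi/2\leq\alpha<\pi$, $\mathcal{M}_\Sigma(\alpha)$ is the class of $f\in\Sigma$ such that $$1+\frac{\alpha-\pi}{2\sin\alpha}<\mathrm{Re}\left\{\frac{zf'(z)}{f(z)}\right\}<1+\frac{\alpha}{2\sin\alpha}\quad(z\in\Delta)$$ and $$1+\frac{\alpha-\pi}{2\sin\alpha}<\mathrm{Re}\left\{\frac{wg'(w)}{g(w)}\right\}<1+\frac{\alpha}{2\sin\alpha}\quad(w\in\Delta),$$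 where both quotients are taken to be $1$ at the origin. *)

theory Defs
  imports "HOL-Complex_Analysis.Complex_Analysis"
begin

abbreviation unit_disc :: "complex set" where
  "unit_disc \<equiv> ball 0 1"

text \<open>\<open>f(z) = z + a\<^sub>2 z\<^sup>2 + a\<^sub>3 z\<^sup>3 + \<dots>\<close> on the unit disc; the values \<open>a 0\<close> and \<open>a 1\<close> are irrelevant.\<close>

definition has_expansion :: "(complex \<Rightarrow> complex) \<Rightarrow> (nat \<Rightarrow> complex) \<Rightarrow> bool" where
  "has_expansion f a \<longleftrightarrow>
     (\<forall>z\<in>unit_disc. (\<lambda>n. a (n + 2) * z ^ (n + 2)) sums (f z - z))"

text \<open>Functions are total on \<^typ>\<open>complex\<close>; only their values on the unit disc matter.\<close>

definition class_A :: "(complex \<Rightarrow> complex) set" where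
  "class_A = {f. f holomorphic_on unit_disc \<and> (\<exists>a. has_expansion f a)}"

definition univalent :: "(complex \<Rightarrow> complex) \<Rightarrow> bool" where
  "univalent f \<longleftrightarrow> f holomorphic_on unit_disc \<and> inj_on f unit_disc"

text \<open>\<open>g\<close> is the analytic continuation to the unit disc of the local inverse of \<open>f\<close> at \<open>0\<close>.
  By the identity theorem, \<open>g\<close> is uniquely determined on the disc by \<open>f\<close>.\<close>

definition inverse_continuation ::
    "(complex \<Rightarrow> complex) \<Rightarrow> (complex \<Rightarrow> complex) \<Rightarrow> bool" where
  "inverse_continuation f g \<longleftrightarrow>
     g holomorphic_on unit_disc \<and> g 0 = 0 \<and>
     (\<forall>\<^sub>F z in nhds 0. g (f z) = z) \<and> (\<forall>\<^sub>F w in nhds 0. f (g w) = w)"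

definition class_Sigma :: "(complex \<Rightarrow> complex) set" where
  "class_Sigma = {f \<in> class_A. univalent f \<and> (\<exists>g. inverse_continuation f g \<and> univalent g)}"

definition starlike_quotient :: "(complex \<Rightarrow> complex) \<Rightarrow> complex \<Rightarrow> complex" where
  "starlike_quotient f z = (if z = 0 then 1 else z * deriv f z / f z)"

definition strip_condition :: "real \<Rightarrow> (complex \<Rightarrow> complex) \<Rightarrow> bool" where
  "strip_condition \<alpha> f \<longleftrightarrow>
     (\<forall>z\<in>unit_disc.
        1 + (\<alpha> - pi) / (2 * sin \<alpha>) < Re (starlike_quotient f z) \<and>
        Re (starlike_quotient f z) < 1 + \<alpha> / (2 * sin \<alpha>))"

definition class_M_Sigma :: "real \<Rightarrow> (complex \<Rightarrow> complex) set" where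
  "class_M_Sigma \<alpha> =
     {f \<in> class_Sigma. strip_condition \<alpha> f \<and>
        (\<exists>g. inverse_continuation f g \<and> strip_condition \<alpha> g)}"

end

theory Submission
  imports Defs
begin

text \<open>
  Put \<open>c = cos \<alpha>\<close> and \<open>F(z) = z f'(z) / f(z) - 1 = a\<^sub>2 z + (2 a\<^sub>3 - a\<^sub>2\<^sup>2) z\<^sup>2 + \<dots>\<close>. The hypothesis
  confines \<open>F\<close> to a vertical strip of width \<open>\<pi> / (2 sin \<alpha>)\<close> containing \<open>0\<close>. The conformal map of
  this strip onto the unit disc that fixes \<open>0\<close> with derivative \<open>1\<close> is
  \<open>x \<mapsto> x + c x\<^sup>2 + \<dots>\<close>, so composing it with \<open>F\<close> gives a self-map of the disc,
  \<open>u(z) = a\<^sub>2 z + (2 a\<^sub>3 - a\<^sub>2\<^sup>2 + c a\<^sub>2\<^sup>2) z\<^sup>2 + \<dots>\<close>, with \<open>u(0) = 0\<close>. For such a map the Schwarz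
  lemma, applied twice, yields \<open>|u\<^sub>2| \<le> 1 - |u\<^sub>1|\<^sup>2\<close> (\<open>schwarz_second_coefficient\<close>).

  The inverse \<open>g(w) = w - a\<^sub>2 w\<^sup>2 + (2 a\<^sub>2\<^sup>2 - a\<^sub>3) w\<^sup>3 - \<dots>\<close> satisfies the same hypothesis and gives
  a second self-map \<open>v\<close> with \<open>v\<^sub>1 = - a\<^sub>2\<close> and \<open>v\<^sub>2 = 3 a\<^sub>2\<^sup>2 - 2 a\<^sub>3 + c a\<^sub>2\<^sup>2\<close>. Hence
  \<open>2 (1 + c) a\<^sub>2\<^sup>2 = u\<^sub>2 + v\<^sub>2\<close> and \<open>4 (a\<^sub>3 - a\<^sub>2\<^sup>2) = u\<^sub>2 - v\<^sub>2\<close>, where both \<open>|u\<^sub>2|\<close> and \<open>|v\<^sub>2|\<close> are at most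
  \<open>1 - |a\<^sub>2|\<^sup>2\<close>. The first identity gives \<open>|a\<^sub>2|\<^sup>2 \<le> 1 / (2 + c)\<close>, which is better than the claimed
  \<open>2 / (2 + c)\<close>; the second gives \<open>|a\<^sub>3 - \<mu> a\<^sub>2\<^sup>2| \<le> |1 - \<mu>| |a\<^sub>2|\<^sup>2 + (1 - |a\<^sub>2|\<^sup>2) / 2\<close>. Since \<open>c \<le> 0\<close>
  for \<open>\<alpha> \<ge> \<pi> / 2\<close>, these two bounds imply both cases of the estimate.
\<close>

section \<open>Low-order coefficients of power series\<close>

lemma fps_mult_nth_2:
  fixes F G :: "'a::comm_ring_1 fps"
  shows "fps_nth (F * G) 2 = fps_nth F 0 * fps_nth G 2 + fps_nth F 1 * fps_nth G 1
    + fps_nth F 2 * fps_nth G 0"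
  by (simp add: fps_mult_nth numeral_2_eq_2)

lemma fps_compose_nth_up_to_3:
  fixes F G :: "'a::comm_ring_1 fps"
  assumes "fps_nth G 0 = 0"
  shows "fps_nth (F oo G) 1 = fps_nth F 1 * fps_nth G 1"
    and "fps_nth (F oo G) 2 = fps_nth F 1 * fps_nth G 2 + fps_nth F 2 * (fps_nth G 1)\<^sup>2"
    and "fps_nth (F oo G) 3 = fps_nth F 1 * fps_nth G 3
      + 2 * fps_nth F 2 * fps_nth G 1 * fps_nth G 2 + fps_nth F 3 * fps_nth G 1 ^ 3"
  using assms
  by (simp_all add: fps_compose_nth fps_mult_nth power2_eq_square power3_eq_cube
      numeral_2_eq_2 numeral_3_eq_3 algebra_simps)

text \<open>The coefficients of the inverse series are found by solving \<open>F(G(w)) = w\<close> order by order.\<close>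

lemma fps_compose_inverse_nth:
  fixes F G :: "'a::comm_ring_1 fps"
  assumes "F oo G = fps_X" "fps_nth G 0 = 0" "fps_nth F 1 = 1"
  shows "fps_nth G 1 = 1" and "fps_nth G 2 = - fps_nth F 2"
    and "fps_nth G 3 = 2 * (fps_nth F 2)\<^sup>2 - fps_nth F 3"
proof -
  note comp = fps_compose_nth_up_to_3[OF assms(2), of F, unfolded assms(1,3)]
  show G1: "fps_nth G 1 = 1"
    using comp(1) by simp
  show G2: "fps_nth G 2 = - fps_nth F 2"
    using comp(2) G1 by (simp add: eq_neg_iff_add_eq_0)
  show "fps_nth G 3 = 2 * (fps_nth F 2)\<^sup>2 - fps_nth F 3"
    using comp(3) unfolding G1 G2 by (simp add: power2_eq_square algebra_simps)
qed

lemma holomorphic_on_disc_has_fps_expansion: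
  assumes "f holomorphic_on unit_disc"
  shows "f has_fps_expansion fps_expansion f 0"
  using assms
  by (intro analytic_at_imp_has_fps_expansion_0)
    (auto simp: analytic_at intro!: exI[of _ unit_disc])

lemma fps_expansion_eqI:
  fixes f g :: "complex \<Rightarrow> complex"
  assumes "f has_fps_expansion F" "g has_fps_expansion G"
    and "\<And>z. norm z < 1 \<Longrightarrow> f z = g z"
  shows "F = G"
proof -
  have "\<forall>\<^sub>F z in nhds 0. z \<in> unit_disc"
    by (intro eventually_nhds_in_open) auto
  then have "\<forall>\<^sub>F z in nhds 0. f z = g z"
    by eventually_elim (use assms(3) in simp)
  then show ?thesis
    using assms(1,2) fps_expansion_unique_complex has_fps_expansion_cong by metis
qed

section \<open>Self-maps of the disc and maps into a strip\<close>

text \<open>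
  Write \<open>u(z) = z \<phi>(z)\<close>, so that \<open>U\<^sub>1\<close> and \<open>U\<^sub>2\<close> are the first two coefficients of \<open>\<phi>\<close>. Unless \<open>u\<close> is a
  rotation, the Schwarz lemma makes \<open>\<phi>\<close> a self-map of the disc. Moving \<open>\<phi>(0)\<close> to \<open>0\<close> by a Moebius
  map divides \<open>\<phi>'(0)\<close> by \<open>1 - |\<phi>(0)|\<^sup>2\<close>, and a second use of the Schwarz lemma bounds the
  quotient by \<open>1\<close>.
\<close>

lemma schwarz_second_coefficient:
  assumes holu: "u holomorphic_on unit_disc" and u0: "u 0 = 0"
    and bound: "\<And>z. norm z < 1 \<Longrightarrow> norm (u z) < 1"
    and U: "u has_fps_expansion U"
  shows "norm (fps_nth U 2) \<le> 1 - (norm (fps_nth U 1))\<^sup>2"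
proof -
  obtain \<phi> where hol\<phi>: "\<phi> holomorphic_on unit_disc"
    and u_eq: "\<And>z. norm z < 1 \<Longrightarrow> u z = z * \<phi> z" and du: "deriv u 0 = \<phi> 0"
    using Schwarz3[OF holu u0] by blast
  define P where "P = fps_expansion \<phi> 0"
  have P: "\<phi> has_fps_expansion P"
    unfolding P_def by (rule holomorphic_on_disc_has_fps_expansion[OF hol\<phi>])
  have "(\<lambda>z. z * \<phi> z) has_fps_expansion fps_X * P"
    by (intro fps_expansion_intros P)
  with U have "U = fps_X * P"
    using u_eq by (rule fps_expansion_eqI)
  then have U1: "fps_nth U 1 = fps_nth P 0" and U2: "fps_nth U 2 = fps_nth P 1"
    by simp_all
  define c where "c = fps_nth P 0"
  have \<phi>0: "\<phi> 0 = c"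
    unfolding c_def using fps_nth_fps_expansion[OF P, of 0] by simp
  show ?thesis
  proof (cases "(\<exists>z. norm z < 1 \<and> z \<noteq> 0 \<and> norm (u z) = norm z) \<or> norm (deriv u 0) = 1")
    case True
    \<comment> \<open>The equality case of the Schwarz lemma, where \<open>\<phi>\<close> has constant modulus \<open>1\<close>.\<close>
    then obtain \<beta> where \<beta>: "\<And>z. norm z < 1 \<Longrightarrow> u z = \<beta> * z" "norm \<beta> = 1"
      using Schwarz_Lemma(3)[OF holu u0 bound, of 0] by force
    have "(\<lambda>z. \<beta> * z) has_fps_expansion fps_const \<beta> * fps_X"
      by (intro fps_expansion_intros)
    with U have "U = fps_const \<beta> * fps_X"
      using \<beta>(1) by (rule fps_expansion_eqI)
    then show ?thesis
      using \<beta>(2) by simp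
  next
    case False
    have \<phi>_lt: "norm (\<phi> z) < 1" if z: "norm z < 1" for z
    proof (cases "z = 0")
      case True
      then show ?thesis
        using False du Schwarz_Lemma(2)[OF holu u0 bound, of 0] by force
    next
      case nz: False
      then have "norm (u z) < norm z"
        using False Schwarz_Lemma(1)[OF holu u0 bound z] z by force
      then show ?thesis
        using nz u_eq[OF z] by (simp add: norm_mult)
    qed
    have c: "norm c < 1"
      using \<phi>_lt[of 0] \<phi>0 by simp
    define \<psi> where "\<psi> = Moebius_function 0 c \<circ> \<phi>"
    have hol\<psi>: "\<psi> holomorphic_on unit_disc"
      unfolding \<psi>_def
      by (rule holomorphic_on_compose_gen[OF hol\<phi> Moebius_function_holomorphic[OF c]])
        (use \<phi>_lt in auto)
    have \<psi>0: "\<psi> 0 = 0"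
      by (simp add: \<psi>_def \<phi>0 Moebius_function_eq_zero)
    have d\<psi>: "norm (deriv \<psi> 0) \<le> 1"
      by (rule Schwarz_Lemma(2)[OF hol\<psi> \<psi>0, of 0])
        (auto simp: \<psi>_def intro!: Moebius_function_norm_lt_1 c \<phi>_lt)
    define Q where "Q = fps_expansion \<psi> 0"
    have Q: "\<psi> has_fps_expansion Q"
      unfolding Q_def by (rule holomorphic_on_disc_has_fps_expansion[OF hol\<psi>])
    have Q0: "fps_nth Q 0 = 0" and Q1: "norm (fps_nth Q 1) \<le> 1"
      using fps_nth_fps_expansion[OF Q, of 0] fps_nth_fps_expansion[OF Q, of 1] \<psi>0 d\<psi>
      by simp_all
    have ne: "1 - cnj c * \<phi> z \<noteq> 0" if "norm z < 1" for z
    proof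
      assume "1 - cnj c * \<phi> z = 0"
      then have "norm (cnj c * \<phi> z) = 1" by simp
      moreover have "norm (cnj c * \<phi> z) < 1 * 1"
        unfolding norm_mult using c \<phi>_lt[OF that] by (intro mult_strict_mono') auto
      ultimately show False by simp
    qed
    \<comment> \<open>Clearing the denominator of \<open>\<psi>\<close> lets \<open>\<phi>'(0)\<close> be read off from the linear coefficients.\<close>
    have "(\<lambda>z. \<psi> z * (1 - cnj c * \<phi> z)) has_fps_expansion Q * (1 - fps_const (cnj c) * P)"
      by (intro fps_expansion_intros P Q)
    moreover have "(\<lambda>z. \<phi> z - c) has_fps_expansion P - fps_const c"
      by (intro fps_expansion_intros P)
    moreover have "\<psi> z * (1 - cnj c * \<phi> z) = \<phi> z - c" if "norm z < 1" for z
      using ne[OF that] by (simp add: \<psi>_def Moebius_function_simple)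
    ultimately have "Q * (1 - fps_const (cnj c) * P) = P - fps_const c"
      by (rule fps_expansion_eqI)
    then have "fps_nth (Q * (1 - fps_const (cnj c) * P)) 1 = fps_nth (P - fps_const c) 1"
      by simp
    then have "fps_nth P 1 = fps_nth Q 1 * (1 - cnj c * c)"
      using Q0 c_def by (simp add: fps_mult_nth_1)
    also have "1 - cnj c * c = of_real (1 - (norm c)\<^sup>2)"
      using complex_norm_square[of c] by (simp add: mult.commute)
    finally have "norm (fps_nth P 1) = norm (fps_nth Q 1) * (1 - (norm c)\<^sup>2)"
      using c by (simp only: norm_mult norm_of_real) (simp add: power_le_one)
    also have "\<dots> \<le> 1 - (norm c)\<^sup>2"
      using Q1 c by (intro mult_left_le_one_le) (auto simp: power_le_one)
    finally show ?thesis
      using U1 U2 c_def by simp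
  qed
qed

text \<open>
  The map \<open>x \<mapsto> exp (2\<i> x sin \<alpha>) cis (-\<alpha>)\<close> carries the strip onto the lower half-plane, and
  \<open>G \<mapsto> (G - cis (-\<alpha>)) / (G - cis \<alpha>)\<close> carries the lower half-plane onto the disc, as \<open>cis \<alpha>\<close> lies in
  the upper one. Up to a unimodular factor their composition is the Riemann map \<open>x + cos \<alpha> x\<^sup>2 + \<dots>\<close>
  of the strip. It turns \<open>F\<close> into a self-map \<open>u\<close> of the disc, whose second coefficient is the
  expression bounded here.
\<close>

lemma strip_second_coefficient:
  assumes \<alpha>: "0 < \<alpha>" "\<alpha> < pi"
    and holF: "F holomorphic_on unit_disc" and F0: "F 0 = 0"
    and strip: "\<And>z. norm z < 1 \<Longrightarrow> (\<alpha> - pi) / (2 * sin \<alpha>) < Re (F z) \<and> Re (F z) < \<alpha> / (2 * sin \<alpha>)"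
    and P: "F has_fps_expansion P"
  shows "norm (fps_nth P 2 + cos \<alpha> * (fps_nth P 1)\<^sup>2) \<le> 1 - (norm (fps_nth P 1))\<^sup>2"
proof -
  define s where "s = sin \<alpha>"
  have s: "s > 0"
    using \<alpha> sin_gt_zero s_def by simp
  define E where "E z = exp (2 * \<i> * s * F z)" for z
  define u where "u z = (E z - 1) / (cis \<alpha> - E z * cis (-\<alpha>))" for z
  have u_lt: "norm (E z - 1) < norm (cis \<alpha> - E z * cis (-\<alpha>))" if "norm z < 1" for z
  proof -
    define G where "G = E z * cis (-\<alpha>)"
    \<comment> \<open>The strip condition says that the argument \<open>2 sin \<alpha> Re (F z) - \<alpha>\<close> of \<open>G\<close> is in \<open>(-\<pi>, 0)\<close>.\<close>
    have "G = exp (2 * \<i> * s * F z - \<i> * \<alpha>)"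
      by (simp add: G_def E_def cis_conv_exp flip: exp_add)
    then have "Im G = exp (- 2 * s * Im (F z)) * sin (2 * s * Re (F z) - \<alpha>)"
      by (simp add: Im_exp)
    moreover have "0 < sin (- (2 * s * Re (F z) - \<alpha>))"
      using strip[OF that] s by (intro sin_gt_zero) (auto simp: field_simps s_def)
    then have "sin (2 * s * Re (F z) - \<alpha>) < 0"
      unfolding sin_minus by simp
    ultimately have "Im G < 0"
      by (simp add: mult_pos_neg)
    \<comment> \<open>So \<open>G\<close> is closer to \<open>cis (-\<alpha>)\<close> than to its mirror image \<open>cis \<alpha>\<close> in the real axis.\<close>
    then have "(Im G + s)\<^sup>2 < (Im G - s)\<^sup>2"
      using s mult_neg_pos[of "Im G" s] by (simp add: power2_eq_square algebra_simps)
    then have "norm (G - cis (-\<alpha>)) < norm (G - cis \<alpha>)"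
      unfolding cmod_def by (simp add: s_def)
    moreover have "G - cis (-\<alpha>) = (E z - 1) * cis (-\<alpha>)"
      by (simp add: G_def algebra_simps)
    then have "norm (G - cis (-\<alpha>)) = norm (E z - 1)"
      by (simp add: norm_mult)
    ultimately show ?thesis
      by (simp add: G_def norm_minus_commute)
  qed
  have ne: "cis \<alpha> - E z * cis (-\<alpha>) \<noteq> 0" if "norm z < 1" for z
    using u_lt[OF that] by auto
  have bound: "norm (u z) < 1" if "norm z < 1" for z
    using u_lt[OF that] ne[OF that] by (simp add: u_def norm_divide)
  have holu: "u holomorphic_on unit_disc"
    unfolding u_def E_def
    by (intro holomorphic_intros holF) (use ne in \<open>auto simp: E_def\<close>)
  have u0: "u 0 = 0"
    by (simp add: u_def E_def F0)
  define U where "U = fps_expansion u 0"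
  have U: "u has_fps_expansion U"
    unfolding U_def by (rule holomorphic_on_disc_has_fps_expansion[OF holu])
  have P0: "fps_nth P 0 = 0" and U0: "fps_nth U 0 = 0"
    using fps_nth_fps_expansion[OF P, of 0] fps_nth_fps_expansion[OF U, of 0] F0 u0 by simp_all
  define k where "k = 2 * \<i> * complex_of_real s"
  define X where "X = fps_exp k oo P"
  have "((\<lambda>x. exp (k * x)) \<circ> F) has_fps_expansion X"
    unfolding X_def by (intro fps_expansion_intros P P0)
  then have X: "E has_fps_expansion X"
    by (simp add: E_def[abs_def] o_def k_def)
  have X0: "fps_nth X 0 = 1" and X1: "fps_nth X 1 = k * fps_nth P 1"
    and X2: "fps_nth X 2 = k * fps_nth P 2 + k\<^sup>2 / 2 * (fps_nth P 1)\<^sup>2"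
    unfolding X_def using fps_compose_nth_up_to_3[OF P0, of "fps_exp k"]
    by (simp_all add: fact_numeral)
  have "(\<lambda>z. u z * (cis \<alpha> - E z * cis (-\<alpha>))) has_fps_expansion
      U * (fps_const (cis \<alpha>) - X * fps_const (cis (-\<alpha>)))"
    by (intro fps_expansion_intros U X)
  moreover have "(\<lambda>z. E z - 1) has_fps_expansion X - 1"
    by (intro fps_expansion_intros X)
  moreover have "u z * (cis \<alpha> - E z * cis (-\<alpha>)) = E z - 1" if "norm z < 1" for z
    using ne[OF that] by (simp add: u_def)
  ultimately have eq: "U * (fps_const (cis \<alpha>) - X * fps_const (cis (-\<alpha>))) = X - 1"
    by (rule fps_expansion_eqI)
  have k_eq: "cis \<alpha> - cis (-\<alpha>) = k"
    by (simp add: k_def s_def complex_eq_iff)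
  have k_ne: "k \<noteq> 0"
    using s by (simp add: k_def)
  have "fps_nth (U * (fps_const (cis \<alpha>) - X * fps_const (cis (-\<alpha>)))) 1 = fps_nth (X - 1) 1"
    using eq by simp
  then have "fps_nth U 1 * k = k * fps_nth P 1"
    using U0 X0 X1 k_eq by (simp add: fps_mult_nth_1)
  then have U1: "fps_nth U 1 = fps_nth P 1"
    using k_ne by simp
  have "fps_nth (U * (fps_const (cis \<alpha>) - X * fps_const (cis (-\<alpha>)))) 2 = fps_nth (X - 1) 2"
    using eq by simp
  then have "fps_nth U 2 * k - fps_nth P 1 * (k * fps_nth P 1 * cis (-\<alpha>))
      = k * fps_nth P 2 + k\<^sup>2 / 2 * (fps_nth P 1)\<^sup>2"
    using U0 U1 X0 X1 X2 k_eq by (simp add: fps_mult_nth_2)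
  then have "k * fps_nth U 2 = k * (fps_nth P 2 + (k / 2 + cis (-\<alpha>)) * (fps_nth P 1)\<^sup>2)"
    by (simp add: algebra_simps power2_eq_square)
  moreover have "k / 2 + cis (-\<alpha>) = cos \<alpha>"
    by (simp add: k_def s_def complex_eq_iff)
  ultimately have "fps_nth U 2 = fps_nth P 2 + cos \<alpha> * (fps_nth P 1)\<^sup>2"
    using k_ne by simp
  then show ?thesis
    using schwarz_second_coefficient[OF holu u0 bound U] U1 by simp
qed

section \<open>Univalent functions whose starlike quotient lies in the strip\<close>

text \<open>
  Univalence gives \<open>h(z) = z k(z)\<close> with \<open>k\<close> free of zeros, which makes the quotient \<open>z h' / h = h' / k\<close>
  holomorphic. Comparing coefficients in \<open>F k = h' - k\<close>, where \<open>F = h' / k - 1\<close>, identifies the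
  coefficients of \<open>F\<close> of order \<open>1\<close> and \<open>2\<close> as \<open>H\<^sub>2\<close> and \<open>2 H\<^sub>3 - H\<^sub>2\<^sup>2\<close>.
\<close>

lemma starlike_strip_coefficient_bound:
  assumes \<alpha>: "0 < \<alpha>" "\<alpha> < pi"
    and h: "univalent h" and strip: "strip_condition \<alpha> h"
    and H: "h has_fps_expansion H" "fps_nth H 0 = 0" "fps_nth H 1 = 1"
  shows "norm (2 * fps_nth H 3 - (fps_nth H 2)\<^sup>2 + cos \<alpha> * (fps_nth H 2)\<^sup>2)
    \<le> 1 - (norm (fps_nth H 2))\<^sup>2"
proof -
  have holh: "h holomorphic_on unit_disc" and inj: "inj_on h unit_disc"
    using h by (auto simp: univalent_def)
  have h0: "h 0 = 0" and dh0: "deriv h 0 = 1"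
    using fps_nth_fps_expansion[OF H(1), of 0] fps_nth_fps_expansion[OF H(1), of 1] H(2,3)
    by simp_all
  obtain k where holk: "k holomorphic_on unit_disc"
    and h_eq: "\<And>z. norm z < 1 \<Longrightarrow> h z = z * k z" and k0: "deriv h 0 = k 0"
    using Schwarz3[OF holh h0] by blast
  have k_ne: "k z \<noteq> 0" if "norm z < 1" for z
  proof (cases "z = 0")
    case True
    then show ?thesis
      using k0 dh0 by simp
  next
    case False
    then have "h z \<noteq> h 0"
      using inj_onD[OF inj, of z 0] that by auto
    then show ?thesis
      using h0 h_eq[OF that] by auto
  qed
  define F where "F z = deriv h z / k z - 1" for z
  have quot: "starlike_quotient h z = F z + 1" if "norm z < 1" for z
    using h_eq[OF that] k0 dh0 by (auto simp: starlike_quotient_def F_def)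
  have holF: "F holomorphic_on unit_disc"
    unfolding F_def by (intro holomorphic_intros holh holk) (use k_ne in auto)
  have F0: "F 0 = 0"
    using k0 dh0 by (simp add: F_def)
  have F_strip: "(\<alpha> - pi) / (2 * sin \<alpha>) < Re (F z) \<and> Re (F z) < \<alpha> / (2 * sin \<alpha>)"
    if "norm z < 1" for z
    using strip[unfolded strip_condition_def, rule_format, of z] that quot[OF that] by simp
  define P where "P = fps_expansion F 0"
  have P: "F has_fps_expansion P"
    unfolding P_def by (rule holomorphic_on_disc_has_fps_expansion[OF holF])
  define K where "K = fps_expansion k 0"
  have K: "k has_fps_expansion K"
    unfolding K_def by (rule holomorphic_on_disc_has_fps_expansion[OF holk])
  have "(\<lambda>z. z * k z) has_fps_expansion fps_X * K"
    by (intro fps_expansion_intros K)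
  with H(1) have HK: "H = fps_X * K"
    using h_eq by (rule fps_expansion_eqI)
  have Kn: "fps_nth K 0 = 1" "fps_nth K 1 = fps_nth H 2" "fps_nth K 2 = fps_nth H 3"
    using H(3) by (simp_all add: HK)
  have P0: "fps_nth P 0 = 0"
    using fps_nth_fps_expansion[OF P, of 0] F0 by simp
  have "(\<lambda>z. F z * k z) has_fps_expansion P * K"
    by (intro fps_expansion_intros P K)
  moreover have "(\<lambda>z. deriv h z - k z) has_fps_expansion fps_deriv H - K"
    by (intro fps_expansion_intros H(1) K)
  moreover have "F z * k z = deriv h z - k z" if "norm z < 1" for z
    using k_ne[OF that] by (simp add: F_def field_simps)
  ultimately have eq: "P * K = fps_deriv H - K"
    by (rule fps_expansion_eqI)
  have "fps_nth (P * K) 1 = fps_nth (fps_deriv H - K) 1"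
    using eq by simp
  then have P1: "fps_nth P 1 = fps_nth H 2"
    using P0 Kn by (simp add: fps_mult_nth_1 numeral_2_eq_2)
  have "fps_nth (P * K) 2 = fps_nth (fps_deriv H - K) 2"
    using eq by simp
  then have P2: "fps_nth P 2 = 2 * fps_nth H 3 - (fps_nth H 2)\<^sup>2"
    using P0 P1 Kn by (simp add: fps_mult_nth_2 power2_eq_square numeral_3_eq_3 algebra_simps)
  show ?thesis
    using strip_second_coefficient[OF \<alpha> holF F0 F_strip P] by (simp only: P1 P2)
qed

text \<open>
  Membership in the class provides one continued inverse that is univalent and one that satisfies
  the strip condition; this lemma identifies them. Near \<open>0\<close> both are inverse to \<open>f\<close>, so
  \<open>g' w = g' (f (g w)) = g w\<close>, and the identity theorem extends the equality to the disc.
\<close>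

lemma inverse_continuation_unique:
  assumes g: "inverse_continuation f g" and g': "inverse_continuation f g'" and "norm w < 1"
  shows "g w = g' w"
proof -
  have holg: "g holomorphic_on unit_disc" and holg': "g' holomorphic_on unit_disc"
    using g g' by (auto simp: inverse_continuation_def)
  have "isCont g 0"
    using holomorphic_on_imp_continuous_on[OF holg] by (simp add: continuous_on_eq_continuous_at)
  then have "filterlim g (nhds 0) (nhds 0)"
    using g by (simp add: isCont_def inverse_continuation_def tendsto_at_iff_tendsto_nhds)
  then have "\<forall>\<^sub>F w in nhds 0. g' (f (g w)) = g w"
    using g' by (auto simp: inverse_continuation_def dest: eventually_compose_filterlim)
  moreover have "\<forall>\<^sub>F w in nhds 0. f (g w) = w"
    using g by (simp add: inverse_continuation_def)
  moreover have "\<forall>\<^sub>F w in nhds 0. w \<in> unit_disc"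
    by (intro eventually_nhds_in_open) auto
  ultimately have "\<forall>\<^sub>F w in nhds 0. w \<in> unit_disc \<and> g w = g' w"
    by eventually_elim simp
  then obtain S where S: "open S" "0 \<in> S" "\<And>w. w \<in> S \<Longrightarrow> w \<in> unit_disc \<and> g w = g' w"
    unfolding eventually_nhds by blast
  show ?thesis
    by (rule analytic_continuation_open[of S unit_disc g g'])
      (use S holg holg' \<open>norm w < 1\<close> in auto)
qed

text \<open>The coefficients of order \<open>0\<close> and \<open>1\<close> come from the normalization \<open>f(z) = z + \<dots>\<close>; the sequence
  \<open>a\<close> supplies those of order at least \<open>2\<close>.\<close>

lemma has_expansion_imp_has_fps_expansion:
  assumes "has_expansion f a"
  shows "f has_fps_expansion Abs_fps (\<lambda>n. if n = 0 then 0 else if n = 1 then 1 else a n)"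
proof (rule has_fps_expansionI)
  let ?b = "\<lambda>n. if n = 0 then 0 else if n = 1 then 1 else a n"
  have "(\<lambda>n. fps_nth (Abs_fps ?b) n * z ^ n) sums f z" if "z \<in> unit_disc" for z
  proof -
    have "(\<lambda>n. ?b (n + 2) * z ^ (n + 2)) sums (f z - z)"
      using assms that by (simp add: has_expansion_def)
    then have "(\<lambda>n. ?b n * z ^ n) sums (f z - z + (\<Sum>i<2. ?b i * z ^ i))"
      by (rule sums_iff_shift[THEN iffD1])
    then show ?thesis
      by (simp add: numeral_2_eq_2)
  qed
  moreover have "\<forall>\<^sub>F z in nhds 0. z \<in> unit_disc"
    by (intro eventually_nhds_in_open) auto
  ultimately show "\<forall>\<^sub>F z in nhds 0. (\<lambda>n. fps_nth (Abs_fps ?b) n * z ^ n) sums f z"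
    by (auto elim: eventually_mono)
qed

section \<open>The resulting inequalities\<close>

text \<open>
  The two numbers bounded in the hypotheses are the second coefficients of the self-maps belonging
  to \<open>f\<close> and to its inverse, with \<open>b = a\<^sub>2\<close> and \<open>d = a\<^sub>3\<close>. Their sum isolates \<open>b\<^sup>2\<close> and their
  difference isolates \<open>d - b\<^sup>2\<close>.
\<close>

lemma inverse_pair_coefficient_bounds:
  fixes b d :: complex and c :: real
  assumes c: "-1 < c"
    and f: "norm (2 * d - b\<^sup>2 + c * b\<^sup>2) \<le> 1 - (norm b)\<^sup>2"
    and g: "norm (3 * b\<^sup>2 - 2 * d + c * b\<^sup>2) \<le> 1 - (norm b)\<^sup>2"
  shows "(norm b)\<^sup>2 \<le> 1 / (2 + c)"
    and "norm (d - of_real \<mu> * b\<^sup>2) \<le> 1 / 2 + (\<bar>1 - \<mu>\<bar> - 1 / 2) * (norm b)\<^sup>2"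
proof -
  define x where "x = 2 * d - b\<^sup>2 + c * b\<^sup>2"
  define y where "y = 3 * b\<^sup>2 - 2 * d + c * b\<^sup>2"
  have x: "norm x \<le> 1 - (norm b)\<^sup>2" and y: "norm y \<le> 1 - (norm b)\<^sup>2"
    using f g by (simp_all only: x_def y_def)
  have "of_real (2 * (1 + c)) * b\<^sup>2 = x + y"
    by (simp add: x_def y_def algebra_simps)
  then have "norm (x + y) = \<bar>2 * (1 + c)\<bar> * (norm b)\<^sup>2"
    by (metis norm_mult norm_of_real norm_power)
  then have "2 * (1 + c) * (norm b)\<^sup>2 = norm (x + y)"
    using c by simp
  also have "\<dots> \<le> 2 * (1 - (norm b)\<^sup>2)"
    using norm_triangle_mono[OF x y] by simp
  finally have "(2 + c) * (norm b)\<^sup>2 \<le> 1"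
    by (simp add: algebra_simps)
  then show "(norm b)\<^sup>2 \<le> 1 / (2 + c)"
    using c by (simp add: field_simps)
  have "d - of_real \<mu> * b\<^sup>2 = of_real (1 - \<mu>) * b\<^sup>2 + (x - y) / 4"
    by (simp add: x_def y_def field_simps)
  then have "norm (d - of_real \<mu> * b\<^sup>2) \<le> \<bar>1 - \<mu>\<bar> * (norm b)\<^sup>2 + norm (x - y) / 4"
    using norm_triangle_ineq[of "of_real (1 - \<mu>) * b\<^sup>2" "(x - y) / 4"]
    by (simp only: norm_mult norm_of_real norm_power norm_divide) simp
  also have "norm (x - y) \<le> 2 * (1 - (norm b)\<^sup>2)"
    using order_trans[OF norm_triangle_ineq4 add_mono[OF x y]] by simp
  finally show "norm (d - of_real \<mu> * b\<^sup>2) \<le> 1 / 2 + (\<bar>1 - \<mu>\<bar> - 1 / 2) * (norm b)\<^sup>2"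
    by (simp add: field_simps)
qed

text \<open>
  Used with \<open>t = |1 - \<mu>|\<close> and \<open>x = |a\<^sub>2|\<^sup>2\<close>. The bound on \<open>y\<close> is affine in \<open>x\<close>, with a
  slope that changes sign at \<open>t = 1 / 2\<close>, so the worst \<open>x\<close> is \<open>0\<close> or \<open>1 / (2 + c)\<close>. As \<open>c \<le> 0\<close>, the
  threshold \<open>(1 + c / 2) / 2\<close> is at most \<open>1 / 2\<close>, so the second case has to treat both signs of
  the slope.
\<close>

lemma piecewise_bound_of_linear_bound:
  fixes c t x y :: real
  assumes c: "-1 < c" "c \<le> 0" and x: "0 \<le> x" "x \<le> 1 / (2 + c)"
    and y: "y \<le> 1 / 2 + (t - 1 / 2) * x"
  shows "t \<le> 1 / 2 * (1 + 1 / 2 * c) \<Longrightarrow> y \<le> 1 / 2"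
    and "t \<ge> 1 / 2 * (1 + 1 / 2 * c) \<Longrightarrow> y \<le> t / (1 + 1 / 2 * c)"
proof -
  have small: "y \<le> 1 / 2" if "t \<le> 1 / 2"
    using y mult_nonpos_nonneg[of "t - 1 / 2" x] that x by linarith
  show "y \<le> 1 / 2" if "t \<le> 1 / 2 * (1 + 1 / 2 * c)"
    using small that c by simp
  show "y \<le> t / (1 + 1 / 2 * c)" if t: "t \<ge> 1 / 2 * (1 + 1 / 2 * c)"
  proof (cases "t \<le> 1 / 2")
    case True
    have "1 / 2 \<le> t / (1 + 1 / 2 * c)"
      using t c by (simp add: field_simps)
    then show ?thesis
      using small[OF True] by linarith
  next
    case False
    then have "y \<le> 1 / 2 + (t - 1 / 2) * (1 / (2 + c))"
      using y mult_left_mono[OF x(2), of "t - 1 / 2"] by linarith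
    also have "\<dots> = t / (1 + 1 / 2 * c) - (t - 1 / 2 - c / 2) / (2 + c)"
      using c by (simp add: divide_simps) (simp add: algebra_simps)
    also have "\<dots> \<le> t / (1 + 1 / 2 * c)"
      using False c by simp
    finally show ?thesis .
  qed
qed

theorem theorem3p1:
  fixes \<alpha> :: real and f :: "complex \<Rightarrow> complex" and a :: "nat \<Rightarrow> complex"
  assumes "pi / 2 \<le> \<alpha>" and "\<alpha> < pi"
    and "f \<in> class_M_Sigma \<alpha>"
    and "has_expansion f a"
  shows "cmod (a 2) \<le> sqrt (2 / (2 + cos \<alpha>)) \<and>
    (\<forall>\<mu>::real.
       (\<bar>1 - \<mu>\<bar> \<le> 1 / 2 * (1 + 1 / 2 * cos \<alpha>) \<longrightarrow>
          cmod (a 3 - of_real \<mu> * (a 2)\<^sup>2) \<le> 1 / 2) \<and>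
       (\<bar>1 - \<mu>\<bar> \<ge> 1 / 2 * (1 + 1 / 2 * cos \<alpha>) \<longrightarrow>
          cmod (a 3 - of_real \<mu> * (a 2)\<^sup>2) \<le> \<bar>1 - \<mu>\<bar> / (1 + 1 / 2 * cos \<alpha>)))"
proof -
  have \<alpha>: "0 < \<alpha>" "\<alpha> < pi"
    using assms(1,2) pi_gt_zero by linarith+
  have "cos pi < cos \<alpha>"
    using \<alpha> by (intro cos_monotone_0_pi) auto
  moreover have "cos \<alpha> \<le> cos (pi / 2)"
    using assms(1) \<alpha> by (intro cos_monotone_0_pi_le) auto
  ultimately have c: "-1 < cos \<alpha>" "cos \<alpha> \<le> 0"
    by simp_all
  obtain g g' where univ_f: "univalent f" and strip_f: "strip_condition \<alpha> f"
    and g: "inverse_continuation f g" and strip_g: "strip_condition \<alpha> g"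
    and g': "inverse_continuation f g'" and univ_g': "univalent g'"
    using assms(3) by (auto simp: class_M_Sigma_def class_Sigma_def)
  have holg: "g holomorphic_on unit_disc" and g0: "g 0 = 0"
    using g by (auto simp: inverse_continuation_def)
  have "inj_on g unit_disc"
    using univ_g' inverse_continuation_unique[OF g g']
    by (simp add: univalent_def inj_on_def)
  then have univ_g: "univalent g"
    using holg by (simp add: univalent_def)
  define H where "H = Abs_fps (\<lambda>n. if n = 0 then 0 else if n = 1 then 1 else a n)"
  have H: "f has_fps_expansion H"
    unfolding H_def by (rule has_expansion_imp_has_fps_expansion[OF assms(4)])
  have Hn: "fps_nth H 0 = 0" "fps_nth H 1 = 1" "fps_nth H 2 = a 2" "fps_nth H 3 = a 3"
    by (simp_all add: H_def)
  define G where "G = fps_expansion g 0"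
  have G: "g has_fps_expansion G"
    unfolding G_def by (rule holomorphic_on_disc_has_fps_expansion[OF holg])
  have Gn0: "fps_nth G 0 = 0"
    using fps_nth_fps_expansion[OF G, of 0] g0 by simp
  have "(f \<circ> g) has_fps_expansion (H oo G)"
    by (intro fps_expansion_intros H G Gn0)
  moreover have "\<forall>\<^sub>F w in nhds 0. (f \<circ> g) w = w"
    using g by (simp add: inverse_continuation_def)
  ultimately have "(\<lambda>w. w) has_fps_expansion (H oo G)"
    using has_fps_expansion_cong[OF _ refl, of "f \<circ> g" "\<lambda>w. w"] by blast
  then have HG: "H oo G = fps_X"
    using has_fps_expansion_fps_X by (rule fps_expansion_unique_complex)
  note Gn = fps_compose_inverse_nth[OF HG Gn0 Hn(2), unfolded Hn]
  have bound_f: "norm (2 * a 3 - (a 2)\<^sup>2 + cos \<alpha> * (a 2)\<^sup>2) \<le> 1 - (norm (a 2))\<^sup>2"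
    using starlike_strip_coefficient_bound[OF \<alpha> univ_f strip_f H Hn(1,2)] Hn by simp
  have "norm (2 * (2 * (a 2)\<^sup>2 - a 3) - (- a 2)\<^sup>2 + cos \<alpha> * (- a 2)\<^sup>2) \<le> 1 - (norm (- a 2))\<^sup>2"
    using starlike_strip_coefficient_bound[OF \<alpha> univ_g strip_g G Gn0 Gn(1)] unfolding Gn .
  moreover have "2 * (2 * (a 2)\<^sup>2 - a 3) - (- a 2)\<^sup>2 = 3 * (a 2)\<^sup>2 - 2 * a 3"
    by simp
  ultimately have bound_g: "norm (3 * (a 2)\<^sup>2 - 2 * a 3 + cos \<alpha> * (a 2)\<^sup>2) \<le> 1 - (norm (a 2))\<^sup>2"
    by simp
  note a2 = inverse_pair_coefficient_bounds(1)[OF c(1) bound_f bound_g]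
  note a3 = inverse_pair_coefficient_bounds(2)[OF c(1) bound_f bound_g]
  have "1 / (2 + cos \<alpha>) \<le> 2 / (2 + cos \<alpha>)"
    using c by (intro divide_right_mono) auto
  then have "cmod (a 2) \<le> sqrt (2 / (2 + cos \<alpha>))"
    using a2 by (intro real_le_rsqrt) linarith
  then show ?thesis
    using piecewise_bound_of_linear_bound[OF c zero_le_power2 a2 a3] by blast
qed

end
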